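(* Let $A$ be a $C^*$-algebra that is generated by its commutators as a ring. Then the assignment $I \mapsto T(I)$ is a bijection from the set of semiprime two-sided ideals in $A$ onto the set of semiprime Lie ideals in $A$. This assignment restricts to a bijection from the set of prime two-sided ideals in $A$ onto the set of prime Lie ideals in $A$.
   Context: A $C^*$-algebra $A$ need not be unital. For $a,b\in A$ put $[a,b]:=ab-ba$ (a commutator); for subsets $E,F\subseteq A$, $[E,F]$ denotes the linear span of $\{[a,b]:a\in E,b\in F\}$. $A$ is generated by its commutators as a ring if every element of $A$ is a finite sum of finite products of commutators of elements of $A$ (no closure is taken). A two-sided ideal in $A$ is a linear subspace $I\subseteq A$ (not necessarily closed) with $ax,xa\in I$ for all $a\in A$, $x\in I$. A two-sided ideal $I$ is prime if $I\neq A$ and, for all two-sided ideals $I_1,I_2$, $I_1I_2\subseteq I$ implies $I_1\subseteq I$ or $I_2\subseteq I$; it is semiprime if for every two-sided ideal $J$, $J^2\subseteq I$ implies $J\subseteq I$ (equivalently, $I$ is an intersection of prime ideals, with $A$ itself being the empty intersection). A Lie ideal in $A$ is a linear subspace $L\subseteq A$ (not necessarily closed) with $[A,L]\subseteq L$. A Lie ideal $L$ is prime if $L\neq A$ and, for all Lie ideals $K_1,K_2\subseteq A$ with $[K_1,K_2]\subseteq L$, one has $K_1\subseteq L$ or $K_2\subseteq L$. A Lie ideal $L$ is semiprime if for every Lie ideal $K\subseteq A$ with $[K,K]\subseteq L$ one has $K\subseteq L$. For a linear subspace $L\subseteq A$, the full normalizer subspace is $T(L):=\{a\in A:[A,a]\subseteq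 L\}$. *)

theory Defs
  imports Complex_Main
begin

text \<open>
  C*-algebras, not assumed to be unital. The zero algebra is not excluded.
\<close>

class cstar_algebra = real_normed_algebra + banach +
  fixes scaleC :: "complex \<Rightarrow> 'a \<Rightarrow> 'a" (infixr "*\<^sub>C" 75)
    and adj :: "'a \<Rightarrow> 'a"
  assumes scaleC_add_right: "c *\<^sub>C (x + y) = c *\<^sub>C x + c *\<^sub>C y"
    and scaleC_add_left: "(c + d) *\<^sub>C x = c *\<^sub>C x + d *\<^sub>C x"
    and scaleC_scaleC: "c *\<^sub>C (d *\<^sub>C x) = (c * d) *\<^sub>C x"
    and scaleC_one: "1 *\<^sub>C x = x"
    and scaleC_of_real: "complex_of_real r *\<^sub>C x = r *\<^sub>R x"
    and mult_scaleC_left: "(c *\<^sub>C x) * y = c *\<^sub>C (x * y)"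
    and mult_scaleC_right: "x * (c *\<^sub>C y) = c *\<^sub>C (x * y)"
    and norm_scaleC: "norm (c *\<^sub>C x) = cmod c * norm x"
    and adj_adj: "adj (adj x) = x"
    and adj_add: "adj (x + y) = adj x + adj y"
    and adj_scaleC: "adj (c *\<^sub>C x) = cnj c *\<^sub>C adj x"
    and adj_mult: "adj (x * y) = adj y * adj x"
    and norm_adj_mult_self: "norm (adj x * x) = (norm x)\<^sup>2"

global_interpretation complex_vector: vector_space "scaleC :: complex \<Rightarrow> 'a \<Rightarrow> 'a::cstar_algebra"
  by unfold_locales
    (rule scaleC_add_right scaleC_add_left scaleC_scaleC scaleC_one)+

definition commutator :: "'a::ring \<Rightarrow> 'a \<Rightarrow> 'a" where
  "commutator a b = a * b - b * a"

definition commutator_span :: "'a::cstar_algebra set \<Rightarrow> 'a set \<Rightarrow> 'a set" where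
  "commutator_span E F = complex_vector.span {commutator a b | a b. a \<in> E \<and> b \<in> F}"

definition product_span :: "'a::cstar_algebra set \<Rightarrow> 'a set \<Rightarrow> 'a set" where
  "product_span E F = complex_vector.span {a * b | a b. a \<in> E \<and> b \<in> F}"

text \<open>
  The products are nonempty, since the ring need not have a unit.
\<close>

inductive_set finite_products :: "'a::ring set \<Rightarrow> 'a set" for S :: "'a set" where
  base: "s \<in> S \<Longrightarrow> s \<in> finite_products S"
| step: "p \<in> finite_products S \<Longrightarrow> s \<in> S \<Longrightarrow> p * s \<in> finite_products S"

definition generates_ring :: "'a::ring set \<Rightarrow> bool" where
  "generates_ring S \<longleftrightarrow> (\<forall>x. \<exists>ps. set ps \<subseteq> finite_products S \<and> x = sum_list ps)"

definition two_sided_ideal :: "'a::cstar_algebra set \<Rightarrow> bool" where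
  "two_sided_ideal I \<longleftrightarrow>
     complex_vector.subspace I \<and> (\<forall>a. \<forall>x\<in>I. a * x \<in> I \<and> x * a \<in> I)"

definition prime_two_sided_ideal :: "'a::cstar_algebra set \<Rightarrow> bool" where
  "prime_two_sided_ideal I \<longleftrightarrow>
     two_sided_ideal I \<and> I \<noteq> UNIV \<and>
     (\<forall>J K. two_sided_ideal J \<longrightarrow> two_sided_ideal K \<longrightarrow>
        product_span J K \<subseteq> I \<longrightarrow> J \<subseteq> I \<or> K \<subseteq> I)"

definition semiprime_two_sided_ideal :: "'a::cstar_algebra set \<Rightarrow> bool" where
  "semiprime_two_sided_ideal I \<longleftrightarrow>
     two_sided_ideal I \<and>
     (\<forall>J. two_sided_ideal J \<longrightarrow> product_span J J \<subseteq> I \<longrightarrow> J \<subseteq> I)"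

definition lie_ideal :: "'a::cstar_algebra set \<Rightarrow> bool" where
  "lie_ideal L \<longleftrightarrow> complex_vector.subspace L \<and> commutator_span UNIV L \<subseteq> L"

definition prime_lie_ideal :: "'a::cstar_algebra set \<Rightarrow> bool" where
  "prime_lie_ideal L \<longleftrightarrow>
     lie_ideal L \<and> L \<noteq> UNIV \<and>
     (\<forall>J K. lie_ideal J \<longrightarrow> lie_ideal K \<longrightarrow>
        commutator_span J K \<subseteq> L \<longrightarrow> J \<subseteq> L \<or> K \<subseteq> L)"

definition semiprime_lie_ideal :: "'a::cstar_algebra set \<Rightarrow> bool" where
  "semiprime_lie_ideal L \<longleftrightarrow>
     lie_ideal L \<and>
     (\<forall>K. lie_ideal K \<longrightarrow> commutator_span K K \<subseteq> L \<longrightarrow> K \<subseteq> L)"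

definition full_normalizer :: "'a::cstar_algebra set \<Rightarrow> 'a set" where
  "full_normalizer L = {a. commutator_span UNIV {a} \<subseteq> L}"

lemma prime_imp_semiprime_two_sided_ideal:
  "prime_two_sided_ideal I \<Longrightarrow> semiprime_two_sided_ideal I"
  unfolding prime_two_sided_ideal_def semiprime_two_sided_ideal_def by blast

lemma prime_imp_semiprime_lie_ideal:
  "prime_lie_ideal L \<Longrightarrow> semiprime_lie_ideal L"
  unfolding prime_lie_ideal_def semiprime_lie_ideal_def by blast

end

theory Submission
  imports Defs
begin

text \<open>
  The proof is ring theory in the style of Herstein, for rings in which one can divide by 2.
  Write \<open>T I\<close> for the full normalizer of an ideal \<open>I\<close>; it is the preimage of the centre of
  \<open>A / I\<close>. All computations take place in \<open>A\<close> modulo \<open>I\<close>, and below an element is called central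
  if it lies in \<open>T I\<close>.

  \<^item> \<^bold>\<open>Well-definedness.\<close> Let \<open>I\<close> be semiprime and let \<open>K\<close> be a Lie ideal with \<open>[K, K] \<subseteq> T I\<close>. Every
    \<open>u \<in> K\<close> satisfies \<open>[u, [u, x]] \<in> T I\<close> for all \<open>x\<close>, and in a semiprime ring without 2-torsion
    this already forces \<open>u\<close> to be central (\<open>semiprime_double_commutator_central\<close>). The analogous
    statement about two Lie ideals in a prime ring rests on \<open>prime_mixed_commutators_central\<close> and
    \<open>prime_mixed_commutators_vanish\<close>. Properness of \<open>T I\<close> for a prime \<open>I\<close> is where the generation
    hypothesis comes in: a commutative quotient of \<open>A\<close> is zero.

  \<^item> \<^bold>\<open>Injectivity.\<close> An ideal \<open>J\<close> inside \<open>T I\<close> satisfies \<open>[a, b] x \<in> I\<close> for \<open>x \<in> J\<close>. As the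
    commutators generate \<open>A\<close>, this gives \<open>A J \<subseteq> I\<close> and hence \<open>J \<subseteq> I\<close>. So a semiprime \<open>I\<close> is the
    largest ideal inside \<open>T I\<close> and can be recovered from it.

  \<^item> \<^bold>\<open>Surjectivity.\<close> Let \<open>L\<close> be a semiprime Lie ideal and \<open>I\<close> the largest ideal inside \<open>L\<close>. An ideal
    whose square lies in \<open>I\<close> has its commutators in \<open>L\<close>, so it lies in \<open>L\<close>, hence in \<open>I\<close>; thus \<open>I\<close>
    is semiprime. Semiprimeness also gives \<open>T L = L\<close>, and a full normalizer is closed under
    products because \<open>[x y, r] = [x, y r] + [y, r x]\<close>. A Lie ideal that is a subring contains
    the ideal generated by its commutators, so \<open>[L, L] \<subseteq> I \<subseteq> T I\<close>. As \<open>T I\<close> is a semiprime Lie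
    ideal, \<open>L \<subseteq> T I\<close>; conversely \<open>T I \<subseteq> T L = L\<close>.
\<close>

section \<open>Membership criteria without spans\<close>

lemma commutator_span_subset_iff:
  assumes "complex_vector.subspace L"
  shows "commutator_span E F \<subseteq> L \<longleftrightarrow> (\<forall>a\<in>E. \<forall>b\<in>F. commutator a b \<in> L)"
proof -
  have "commutator_span E F \<subseteq> L \<longleftrightarrow> {commutator a b | a b. a \<in> E \<and> b \<in> F} \<subseteq> L"
    unfolding commutator_span_def
    by (rule iffI, rule subset_trans[OF complex_vector.span_superset], assumption)
      (rule complex_vector.span_minimal[OF _ assms])
  then show ?thesis by blast
qed

lemma product_span_subset_iff:
  assumes "complex_vector.subspace L"
  shows "product_span E F \<subseteq> L \<longleftrightarrow> (\<forall>a\<in>E. \<forall>b\<in>F. a * b \<in> L)"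
proof -
  have "product_span E F \<subseteq> L \<longleftrightarrow> {a * b | a b. a \<in> E \<and> b \<in> F} \<subseteq> L"
    unfolding product_span_def
    by (rule iffI, rule subset_trans[OF complex_vector.span_superset], assumption)
      (rule complex_vector.span_minimal[OF _ assms])
  then show ?thesis by blast
qed

lemma full_normalizer_iff:
  assumes "complex_vector.subspace L"
  shows "u \<in> full_normalizer L \<longleftrightarrow> (\<forall>a. commutator a u \<in> L)"
  unfolding full_normalizer_def using commutator_span_subset_iff[OF assms] by simp

lemma lie_ideal_iff:
  "lie_ideal L \<longleftrightarrow> complex_vector.subspace L \<and> (\<forall>a. \<forall>u\<in>L. commutator a u \<in> L)"
  unfolding lie_ideal_def by (simp add: commutator_span_subset_iff cong: conj_cong)

lemma commutator_swap: "commutator a b = - commutator b a"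
  by (simp add: commutator_def)

lemma full_normalizer_commutatorD:
  assumes "complex_vector.subspace L" "u \<in> full_normalizer L"
  shows "commutator a u \<in> L" "commutator u a \<in> L"
proof -
  show "commutator a u \<in> L"
    using assms full_normalizer_iff by blast
  then show "commutator u a \<in> L"
    using complex_vector.subspace_neg[OF assms(1)] by (subst commutator_swap) blast
qed

lemma lie_ideal_commutatorD:
  assumes "lie_ideal L" "u \<in> L"
  shows "commutator a u \<in> L" "commutator u a \<in> L"
proof -
  show "commutator a u \<in> L"
    using assms lie_ideal_iff by blast
  moreover have "complex_vector.subspace L"
    using assms(1) lie_ideal_iff by blast
  ultimately show "commutator u a \<in> L"
    using complex_vector.subspace_neg by (subst commutator_swap) blast
qed

lemma two_sided_idealD:
  assumes "two_sided_ideal I"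
  shows "complex_vector.subspace I" "0 \<in> I"
    "\<And>x y. x \<in> I \<Longrightarrow> y \<in> I \<Longrightarrow> x + y \<in> I"
    "\<And>x y. x \<in> I \<Longrightarrow> y \<in> I \<Longrightarrow> x - y \<in> I"
    "\<And>x. x \<in> I \<Longrightarrow> - x \<in> I"
    "\<And>a x. x \<in> I \<Longrightarrow> a * x \<in> I"
    "\<And>a x. x \<in> I \<Longrightarrow> x * a \<in> I"
proof -
  show sub: "complex_vector.subspace I"
    using assms unfolding two_sided_ideal_def by blast
  show "0 \<in> I" by (rule complex_vector.subspace_0[OF sub])
  show "x + y \<in> I" "x - y \<in> I" if "x \<in> I" "y \<in> I" for x y
    using complex_vector.subspace_add[OF sub that] complex_vector.subspace_diff[OF sub that] .
  show "- x \<in> I" "a * x \<in> I" "x * a \<in> I" if "x \<in> I" for a x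
    using complex_vector.subspace_neg[OF sub that] assms that
    unfolding two_sided_ideal_def by blast+
qed

lemma two_sided_ideal_imp_lie_ideal: "two_sided_ideal I \<Longrightarrow> lie_ideal I"
  unfolding lie_ideal_iff commutator_def by (auto intro: two_sided_idealD)

lemma subspace_mult_left_preimage:
  assumes "complex_vector.subspace L"
  shows "complex_vector.subspace {x. a * x \<in> L}"
  using assms unfolding complex_vector.subspace_def
  by (auto simp: distrib_left mult_scaleC_right)

lemma subspace_mult_right_preimage:
  assumes "complex_vector.subspace L"
  shows "complex_vector.subspace {x. x * a \<in> L}"
  using assms unfolding complex_vector.subspace_def
  by (auto simp: distrib_right mult_scaleC_left)

lemma two_sided_ideal_product_span:
  assumes J: "two_sided_ideal J" and K: "two_sided_ideal K"
  shows "two_sided_ideal (product_span J K)"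
proof -
  define P where "P = product_span J K"
  have sub: "complex_vector.subspace P"
    unfolding P_def product_span_def by simp
  have gen: "x * y \<in> P" if "x \<in> J" "y \<in> K" for x y
    using product_span_subset_iff[OF sub, of J K] that by (simp add: P_def)
  have "P \<subseteq> {x. a * x \<in> P}" for a
    using product_span_subset_iff[OF subspace_mult_left_preimage[OF sub], of J K a]
      gen two_sided_idealD(6)[OF J]
    by (simp add: P_def mult.assoc[symmetric])
  moreover have "P \<subseteq> {x. x * a \<in> P}" for a
    using product_span_subset_iff[OF subspace_mult_right_preimage[OF sub], of J K a]
      gen two_sided_idealD(7)[OF K]
    by (simp add: P_def mult.assoc)
  ultimately show ?thesis
    using sub unfolding P_def[symmetric] two_sided_ideal_def by blast
qed

section \<open>Elementwise primeness and semiprimeness\<close>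

text \<open>
  Without a unit the ideal generated by \<open>x\<close> is awkward to write down. Its place is taken by
  annihilators modulo \<open>I\<close>, which are ideals for trivial reasons.
\<close>

definition annihilator_mod :: "'a::ring set \<Rightarrow> 'a set \<Rightarrow> 'a set" where
  "annihilator_mod I S = {w. \<forall>x\<in>S. \<forall>a. x * a * w \<in> I}"

definition left_annihilator_mod :: "'a::ring set \<Rightarrow> 'a set \<Rightarrow> 'a set" where
  "left_annihilator_mod I S = {w. \<forall>x\<in>S. \<forall>a. w * a * x \<in> I}"

lemma two_sided_ideal_annihilator_mod:
  assumes I: "two_sided_ideal I"
  shows "two_sided_ideal (annihilator_mod I S)" "two_sided_ideal (left_annihilator_mod I S)"
proof -
  note sub = two_sided_idealD(1)[OF I, unfolded complex_vector.subspace_def]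
  show "two_sided_ideal (annihilator_mod I S)"
    unfolding two_sided_ideal_def
  proof (intro conjI allI ballI)
    show "complex_vector.subspace (annihilator_mod I S)"
      using sub unfolding annihilator_mod_def complex_vector.subspace_def
      by (simp add: distrib_left mult_scaleC_right)
    fix b w assume w: "w \<in> annihilator_mod I S"
    then show "w * b \<in> annihilator_mod I S"
      using two_sided_idealD(7)[OF I] by (simp add: annihilator_mod_def mult.assoc[symmetric])
    have "x * (a * b) * w \<in> I" if "x \<in> S" for x a
      using w that unfolding annihilator_mod_def by blast
    then show "b * w \<in> annihilator_mod I S"
      by (simp add: annihilator_mod_def mult.assoc)
  qed
  show "two_sided_ideal (left_annihilator_mod I S)"
    unfolding two_sided_ideal_def
  proof (intro conjI allI ballI)
    show "complex_vector.subspace (left_annihilator_mod I S)"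
      using sub unfolding left_annihilator_mod_def complex_vector.subspace_def
      by (simp add: distrib_right mult_scaleC_left)
    fix b w assume w: "w \<in> left_annihilator_mod I S"
    then show "b * w \<in> left_annihilator_mod I S"
      using two_sided_idealD(6)[OF I] by (simp add: left_annihilator_mod_def mult.assoc)
    have "w * (b * a) * x \<in> I" if "x \<in> S" for x a
      using w that unfolding left_annihilator_mod_def by blast
    then show "w * b \<in> left_annihilator_mod I S"
      by (simp add: left_annihilator_mod_def mult.assoc)
  qed
qed

lemma two_sided_ideal_Int:
  "two_sided_ideal J \<Longrightarrow> two_sided_ideal K \<Longrightarrow> two_sided_ideal (J \<inter> K)"
  unfolding two_sided_ideal_def by (simp add: complex_vector.subspace_inter)

lemma semiprime_ideal_squareD:
  assumes "semiprime_two_sided_ideal I" "two_sided_ideal J"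
    and "\<And>x y. x \<in> J \<Longrightarrow> y \<in> J \<Longrightarrow> x * y \<in> I"
  shows "J \<subseteq> I"
proof -
  have "complex_vector.subspace I"
    using assms(1) unfolding semiprime_two_sided_ideal_def two_sided_ideal_def by blast
  then have "product_span J J \<subseteq> I"
    by (simp add: product_span_subset_iff assms(3))
  then show ?thesis
    using assms(1,2) unfolding semiprime_two_sided_ideal_def by blast
qed

lemma prime_ideal_productD:
  assumes "prime_two_sided_ideal I" "two_sided_ideal J" "two_sided_ideal K"
    and "\<And>x y. x \<in> J \<Longrightarrow> y \<in> K \<Longrightarrow> x * y \<in> I"
  shows "J \<subseteq> I \<or> K \<subseteq> I"
proof -
  have "complex_vector.subspace I"
    using assms(1) unfolding prime_two_sided_ideal_def two_sided_ideal_def by blast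
  then have "product_span J K \<subseteq> I"
    by (simp add: product_span_subset_iff assms(4))
  then show ?thesis
    using assms(1-3) unfolding prime_two_sided_ideal_def by blast
qed

text \<open>
  The square of the ideal \<open>J J\<close> consists of sums of fourfold products, so semiprimeness applies
  first to \<open>J J\<close> and then to \<open>J\<close>.
\<close>

lemma semiprime_ideal_cubeD:
  assumes semi: "semiprime_two_sided_ideal I" and J: "two_sided_ideal J"
    and cube: "\<And>x y z. x \<in> J \<Longrightarrow> y \<in> J \<Longrightarrow> z \<in> J \<Longrightarrow> x * y * z \<in> I"
  shows "J \<subseteq> I"
proof -
  have I: "two_sided_ideal I"
    using semi unfolding semiprime_two_sided_ideal_def by blast
  note sub = two_sided_idealD(1)[OF I]
  have JJJ: "p * z \<in> I" if "p \<in> product_span J J" "z \<in> J" for p z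
  proof -
    have "product_span J J \<subseteq> {p. p * z \<in> I}"
      using product_span_subset_iff[OF subspace_mult_right_preimage[OF sub]] cube that(2) by blast
    then show ?thesis using that(1) by blast
  qed
  have "product_span J J \<subseteq> J"
    using product_span_subset_iff[OF two_sided_idealD(1)[OF J]] two_sided_idealD(6)[OF J] by blast
  then have "product_span J J \<subseteq> I"
    using semiprime_ideal_squareD[OF semi two_sided_ideal_product_span[OF J J]] JJJ by blast
  then show ?thesis
    using semi J unfolding semiprime_two_sided_ideal_def by blast
qed

lemma semiprime_elementD:
  assumes semi: "semiprime_two_sided_ideal I" and x: "\<And>a. x * a * x \<in> I"
  shows "x \<in> I"
proof -
  have I: "two_sided_ideal I"
    using semi unfolding semiprime_two_sided_ideal_def by blast
  define Y where "Y = annihilator_mod I {x}"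
  define J where "J = left_annihilator_mod I Y \<inter> Y"
  have J: "two_sided_ideal J"
    unfolding J_def Y_def by (intro two_sided_ideal_Int two_sided_ideal_annihilator_mod I)
  have "x \<in> J"
    using x by (simp add: J_def Y_def annihilator_mod_def left_annihilator_mod_def)
  moreover have "J \<subseteq> I"
    by (rule semiprime_ideal_cubeD[OF semi J]) (simp add: J_def left_annihilator_mod_def)
  ultimately show ?thesis by blast
qed

text \<open>
  Let \<open>Y\<close> be the ideal of all \<open>w\<close> with \<open>x A w \<subseteq> I\<close> and \<open>X\<close> the ideal of all \<open>z\<close> with \<open>z A Y \<subseteq> I\<close>.
  The intersection of \<open>X\<close> and \<open>Y\<close> has its cube in \<open>I\<close>, so it lies in \<open>I\<close>, and it contains \<open>X Y\<close>.
  Primeness yields \<open>X \<subseteq> I\<close> or \<open>Y \<subseteq> I\<close>, while \<open>x \<in> X\<close> and \<open>y \<in> Y\<close>.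
\<close>

lemma prime_elementD:
  assumes prime: "prime_two_sided_ideal I" and xy: "\<And>a. x * a * y \<in> I"
  shows "x \<in> I \<or> y \<in> I"
proof -
  have I: "two_sided_ideal I"
    using prime unfolding prime_two_sided_ideal_def by blast
  define Y where "Y = annihilator_mod I {x}"
  define X where "X = left_annihilator_mod I Y"
  have XY: "two_sided_ideal X" "two_sided_ideal Y"
    unfolding X_def Y_def by (intro two_sided_ideal_annihilator_mod I)+
  have "X \<inter> Y \<subseteq> I"
    by (rule semiprime_ideal_cubeD[OF prime_imp_semiprime_two_sided_ideal[OF prime]
          two_sided_ideal_Int[OF XY]])
      (simp add: X_def left_annihilator_mod_def)
  then have "z * w \<in> I" if "z \<in> X" "w \<in> Y" for z w
    using that two_sided_idealD(7)[OF XY(1)] two_sided_idealD(6)[OF XY(2)] by blast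
  then have "X \<subseteq> I \<or> Y \<subseteq> I"
    by (rule prime_ideal_productD[OF prime XY])
  moreover have "x \<in> X" "y \<in> Y"
    using xy by (simp_all add: X_def Y_def annihilator_mod_def left_annihilator_mod_def)
  ultimately show ?thesis by blast
qed

section \<open>Herstein's commutator lemmas modulo an ideal\<close>

lemma two_sided_ideal_halve:
  assumes "two_sided_ideal I" "x + x \<in> I"
  shows "x \<in> I"
proof -
  have "(1/2) *\<^sub>C (x + x) = (1/2 + 1/2) *\<^sub>C x"
    by (simp only: scaleC_add_left scaleC_add_right)
  also have "\<dots> = x" by (simp add: scaleC_one)
  finally show ?thesis
    using assms complex_vector.subspace_scale two_sided_idealD(1) by metis
qed

text \<open>
  Put \<open>d x = [u, x]\<close>, a derivation with \<open>d (d x) \<in> I\<close>. The Leibniz rule for \<open>d (d (x y))\<close> yields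
  \<open>2 d x d y \<in> I\<close>, and replacing \<open>y\<close> by \<open>y x\<close> gives \<open>d x y d x \<in> I\<close>.
\<close>

lemma semiprime_double_commutator_vanishes:
  assumes semi: "semiprime_two_sided_ideal I"
    and dd: "\<And>x. commutator u (commutator u x) \<in> I"
  shows "u \<in> full_normalizer I"
proof -
  have I: "two_sided_ideal I"
    using semi unfolding semiprime_two_sided_ideal_def by blast
  note [intro] = two_sided_idealD[OF I]
  let ?d = "commutator u"
  have prod: "?d x * ?d y \<in> I" for x y
  proof (rule two_sided_ideal_halve[OF I])
    have "?d x * ?d y + ?d x * ?d y = ?d (?d (x * y)) - ?d (?d x) * y - x * ?d (?d y)"
      by (simp add: commutator_def algebra_simps)
    then show "?d x * ?d y + ?d x * ?d y \<in> I" using dd by auto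
  qed
  have "?d x \<in> I" for x
  proof (rule semiprime_elementD[OF semi])
    fix y
    have "?d x * y * ?d x = ?d x * ?d (y * x) - ?d x * ?d y * x"
      by (simp add: commutator_def algebra_simps)
    then show "?d x * y * ?d x \<in> I" using prod by auto
  qed
  then show ?thesis
    unfolding full_normalizer_iff[OF two_sided_idealD(1)[OF I]]
    by (subst commutator_swap) (blast intro: two_sided_idealD(5)[OF I])
qed

lemma semiprime_central_square_zero:
  assumes semi: "semiprime_two_sided_ideal I"
    and s: "s \<in> full_normalizer I" "s * s \<in> I"
  shows "s \<in> I"
proof (rule semiprime_elementD[OF semi])
  fix a
  have I: "two_sided_ideal I"
    using semi unfolding semiprime_two_sided_ideal_def by blast
  note [intro] = two_sided_idealD[OF I]
  have "s * a * s = s * s * a + s * commutator a s"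
    by (simp add: commutator_def algebra_simps)
  then show "s * a * s \<in> I"
    using s(2) full_normalizer_commutatorD(1)[OF two_sided_idealD(1)[OF I] s(1)] by auto
qed

text \<open>
  If \<open>d (d x)\<close> is central for all \<open>x\<close>, then so is \<open>d (d (x u)) = d (d x) u\<close>; commuting it with
  \<open>y = d x\<close> shows that the central element \<open>d (d x)\<close> squares to zero.
\<close>

lemma semiprime_double_commutator_central:
  assumes semi: "semiprime_two_sided_ideal I"
    and dd: "\<And>x. commutator u (commutator u x) \<in> full_normalizer I"
  shows "u \<in> full_normalizer I"
proof (rule semiprime_double_commutator_vanishes[OF semi])
  fix x
  have I: "two_sided_ideal I"
    using semi unfolding semiprime_two_sided_ideal_def by blast
  note [intro] = two_sided_idealD[OF I]
  note central = full_normalizer_commutatorD[OF two_sided_idealD(1)[OF I]]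
  let ?d = "commutator u"
  define s where "s = ?d (?d x)"
  have "s * s = commutator (?d x) s * u - commutator (?d x) (?d (?d (x * u)))"
    unfolding s_def by (simp add: commutator_def algebra_simps)
  then have "s * s \<in> I"
    using central(1)[OF dd] unfolding s_def by auto
  then show "?d (?d x) \<in> I"
    using semiprime_central_square_zero[OF semi] dd unfolding s_def by blast
qed

text \<open>
  With \<open>z = [u, v]\<close>, commuting the central element \<open>[u, [v, x v]] = [u, [v, x]] v + [v, x] z\<close> with
  \<open>v\<close> gives \<open>[v, [v, x]] z \<in> I\<close>. As \<open>z\<close> is central, either \<open>z \<in> I\<close> or \<open>[v, [v, x]] \<in> I\<close> for all \<open>x\<close>.
  In the second case \<open>v\<close> is central, so that again \<open>z \<in> I\<close>.
\<close>

lemma prime_mixed_commutators_central: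
  assumes prime: "prime_two_sided_ideal I"
    and uv: "commutator u v \<in> full_normalizer I"
    and uvx: "\<And>x. commutator u (commutator v x) \<in> full_normalizer I"
  shows "commutator u v \<in> I"
proof (rule ccontr)
  assume not_in: "commutator u v \<notin> I"
  have I: "two_sided_ideal I"
    using prime unfolding prime_two_sided_ideal_def by blast
  note [intro] = two_sided_idealD[OF I]
  note central = full_normalizer_commutatorD[OF two_sided_idealD(1)[OF I]]
  define z where "z = commutator u v"
  let ?d = "commutator v"
  have "?d (?d x) \<in> I" for x
  proof -
    have "?d (?d x) * z = ?d (commutator u (?d (x * v))) - ?d (commutator u (?d x)) * v
        - ?d x * ?d z"
      unfolding z_def by (simp add: commutator_def algebra_simps)
    moreover have "?d (commutator u (?d x)) * v \<in> I" "?d x * ?d z \<in> I"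
      using central(1)[OF uvx] central(1)[OF uv] unfolding z_def by blast+
    ultimately have ddz: "?d (?d x) * z \<in> I"
      using central(1)[OF uvx] two_sided_idealD(4)[OF I] by metis
    have "?d (?d x) * a * z \<in> I" for a
    proof -
      have "?d (?d x) * a * z = ?d (?d x) * z * a + ?d (?d x) * commutator a z"
        by (simp add: commutator_def algebra_simps)
      then show ?thesis using ddz central(1)[OF uv] unfolding z_def by auto
    qed
    then show ?thesis
      using prime_elementD[OF prime] not_in unfolding z_def by blast
  qed
  then have "v \<in> full_normalizer I"
    using semiprime_double_commutator_vanishes prime_imp_semiprime_two_sided_ideal[OF prime] by blast
  then show False using central(1) not_in by blast
qed

text \<open>
  Put \<open>e x = [u, x]\<close> and \<open>d x = [v, x]\<close>, so that \<open>e (d x) \<in> I\<close>. The Leibniz rule for \<open>e (d (x y))\<close>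
  gives \<open>d x e y + e x d y \<in> I\<close>, then \<open>e x d (d y) \<in> I\<close> on replacing \<open>y\<close> by \<open>d y\<close>, and finally
  \<open>e x w d (d y) \<in> I\<close> on replacing \<open>x\<close> by \<open>x w\<close>.
\<close>

lemma prime_mixed_commutators_vanish:
  assumes prime: "prime_two_sided_ideal I"
    and uvx: "\<And>x. commutator u (commutator v x) \<in> I"
  shows "u \<in> full_normalizer I \<or> v \<in> full_normalizer I"
proof -
  have I: "two_sided_ideal I"
    using prime unfolding prime_two_sided_ideal_def by blast
  note [intro] = two_sided_idealD[OF I]
  note sub = two_sided_idealD(1)[OF I]
  let ?e = "commutator u" and ?d = "commutator v"
  have leibniz: "?d x * ?e y + ?e x * ?d y \<in> I" for x y
  proof -
    have "?d x * ?e y + ?e x * ?d y = ?e (?d (x * y)) - ?e (?d x) * y - x * ?e (?d y)"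
      by (simp add: commutator_def algebra_simps)
    then show ?thesis using uvx by auto
  qed
  have edd: "?e x * ?d (?d y) \<in> I" for x y
  proof -
    have "?e x * ?d (?d y) = (?d x * ?e (?d y) + ?e x * ?d (?d y)) - ?d x * ?e (?d y)"
      by simp
    then show ?thesis using leibniz[of x "?d y"] uvx by (metis two_sided_idealD(4,6)[OF I])
  qed
  have "?e x * w * ?d (?d y) \<in> I" for x w y
  proof -
    have "?e x * w * ?d (?d y) = ?e (x * w) * ?d (?d y) - x * (?e w * ?d (?d y))"
      by (simp add: commutator_def algebra_simps)
    then show ?thesis using edd by auto
  qed
  then have "?e x \<in> I \<or> ?d (?d y) \<in> I" for x y
    using prime_elementD[OF prime] by blast
  then consider "\<forall>x. ?e x \<in> I" | "\<forall>y. ?d (?d y) \<in> I" by blast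
  then show ?thesis
  proof cases
    case 1
    then have "commutator x u \<in> I" for x
      using two_sided_idealD(5)[OF I] by (subst commutator_swap) blast
    then show ?thesis using full_normalizer_iff[OF sub] by blast
  next
    case 2
    then show ?thesis
      using semiprime_double_commutator_vanishes prime_imp_semiprime_two_sided_ideal[OF prime]
      by blast
  qed
qed

section \<open>From ideals to Lie ideals\<close>

lemma lie_ideal_full_normalizer:
  assumes L: "lie_ideal L"
  shows "lie_ideal (full_normalizer L)"
proof -
  have sub: "complex_vector.subspace L" using L lie_ideal_iff by blast
  have "complex_vector.subspace {u. commutator a u \<in> L}" for a
  proof -
    have "commutator a (u + v) = commutator a u + commutator a v"
      and "commutator a (c *\<^sub>C u) = c *\<^sub>C commutator a u" for u v c
      by (simp_all add: commutator_def algebra_simps mult_scaleC_left mult_scaleC_right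
          complex_vector.scale_right_diff_distrib)
    moreover have "commutator a 0 = 0" by (simp add: commutator_def)
    ultimately show ?thesis
      using sub unfolding complex_vector.subspace_def by simp
  qed
  then have "complex_vector.subspace {u. \<forall>a. commutator a u \<in> L}"
    unfolding complex_vector.subspace_def by simp
  moreover have "full_normalizer L = {u. \<forall>a. commutator a u \<in> L}"
    using full_normalizer_iff[OF sub] by blast
  ultimately show ?thesis
    unfolding lie_ideal_iff using lie_ideal_commutatorD(1)[OF L] by auto
qed

lemma subset_full_normalizer: "lie_ideal L \<Longrightarrow> L \<subseteq> full_normalizer L"
  using full_normalizer_iff lie_ideal_iff by blast

lemma semiprime_lie_ideal_full_normalizer:
  assumes semi: "semiprime_two_sided_ideal I"
  shows "semiprime_lie_ideal (full_normalizer I)"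
proof -
  have "two_sided_ideal I"
    using semi unfolding semiprime_two_sided_ideal_def by blast
  then have T: "lie_ideal (full_normalizer I)"
    using lie_ideal_full_normalizer two_sided_ideal_imp_lie_ideal by blast
  have "K \<subseteq> full_normalizer I"
    if K: "lie_ideal K" and KK: "commutator_span K K \<subseteq> full_normalizer I" for K
  proof
    fix u assume u: "u \<in> K"
    have "commutator u (commutator u x) \<in> full_normalizer I" for x
      using KK u lie_ideal_commutatorD(2)[OF K u] T commutator_span_subset_iff lie_ideal_iff by blast
    then show "u \<in> full_normalizer I"
      by (rule semiprime_double_commutator_central[OF semi])
  qed
  then show ?thesis
    using T unfolding semiprime_lie_ideal_def by blast
qed

lemma right_ideal_containing_commutators_eq_UNIV:
  fixes S :: "'a::ring set"
  assumes gen: "generates_ring {commutator a b | a b :: 'a. True}"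
    and zero: "0 \<in> S" and add: "\<And>x y. x \<in> S \<Longrightarrow> y \<in> S \<Longrightarrow> x + y \<in> S"
    and right: "\<And>x a. x \<in> S \<Longrightarrow> x * a \<in> S"
    and comm: "\<And>a b. commutator a b \<in> S"
  shows "S = UNIV"
proof -
  let ?C = "{commutator a b | a b :: 'a. True}"
  have products: "p \<in> S" if "p \<in> finite_products ?C" for p
    using that
  proof induction
    case (base c)
    then show ?case using comm by blast
  next
    case (step p c)
    show ?case by (rule right[OF step.IH])
  qed
  have sums: "sum_list ps \<in> S" if "set ps \<subseteq> finite_products ?C" for ps
    using that by (induction ps) (simp_all add: zero add products)
  have "x \<in> S" for x
  proof -
    obtain ps where "set ps \<subseteq> finite_products ?C" "x = sum_list ps"
      using gen unfolding generates_ring_def by blast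
    then show ?thesis using sums by simp
  qed
  then show ?thesis by blast
qed

lemma prime_lie_ideal_full_normalizer:
  fixes I :: "'a::cstar_algebra set"
  assumes gen: "generates_ring {commutator a b | a b :: 'a. True}"
    and prime: "prime_two_sided_ideal I"
  shows "prime_lie_ideal (full_normalizer I)"
proof -
  have I: "two_sided_ideal I" and proper: "I \<noteq> UNIV"
    using prime unfolding prime_two_sided_ideal_def by blast+
  note sub = two_sided_idealD(1)[OF I]
  have T: "lie_ideal (full_normalizer I)"
    using lie_ideal_full_normalizer two_sided_ideal_imp_lie_ideal I by blast
  have "full_normalizer I \<noteq> UNIV"
  proof
    assume "full_normalizer I = UNIV"
    then have "commutator a b \<in> I" for a b
      using full_normalizer_iff[OF sub] by blast
    then show False
      using right_ideal_containing_commutators_eq_UNIV[OF gen two_sided_idealD(2,3,7)[OF I]] proper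
      by blast
  qed
  moreover have "J \<subseteq> full_normalizer I \<or> K \<subseteq> full_normalizer I"
    if J: "lie_ideal J" and K: "lie_ideal K"
      and "commutator_span J K \<subseteq> full_normalizer I" for J K
  proof -
    have JK: "commutator u v \<in> full_normalizer I" if "u \<in> J" "v \<in> K" for u v
      using \<open>commutator_span J K \<subseteq> full_normalizer I\<close> that T
        commutator_span_subset_iff lie_ideal_iff by blast
    have "commutator u v \<in> I" if "u \<in> J" "v \<in> K" for u v
      using prime_mixed_commutators_central[OF prime] JK that lie_ideal_commutatorD(2)[OF K] by blast
    then have "u \<in> full_normalizer I \<or> v \<in> full_normalizer I" if "u \<in> J" "v \<in> K" for u v
      using prime_mixed_commutators_vanish[OF prime] that lie_ideal_commutatorD(2)[OF K] by blast
    then show ?thesis by blast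
  qed
  ultimately show ?thesis
    using T unfolding prime_lie_ideal_def by blast
qed

text \<open>
  For \<open>x \<in> J\<close> both \<open>[a, b x]\<close> and \<open>b [a, x]\<close> lie in \<open>I\<close>, so their difference \<open>[a, b] x\<close> does. The
  elements \<open>c\<close> with \<open>c J \<subseteq> I\<close> form a right ideal containing all commutators.
\<close>

lemma ideal_in_full_normalizer:
  fixes I :: "'a::cstar_algebra set"
  assumes gen: "generates_ring {commutator a b | a b :: 'a. True}"
    and semi: "semiprime_two_sided_ideal I"
    and J: "two_sided_ideal J" and JT: "J \<subseteq> full_normalizer I"
  shows "J \<subseteq> I"
proof -
  have I: "two_sided_ideal I"
    using semi unfolding semiprime_two_sided_ideal_def by blast
  note [intro] = two_sided_idealD[OF I]
  define S where "S = {c. \<forall>x\<in>J. c * x \<in> I}"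
  have "S = UNIV"
  proof (rule right_ideal_containing_commutators_eq_UNIV[OF gen])
    show "commutator a b \<in> S" for a b
    proof -
      have "commutator a b * x \<in> I" if "x \<in> J" for x
      proof -
        have "commutator a b * x = commutator a (b * x) - b * commutator a x"
          by (simp add: commutator_def algebra_simps)
        moreover have "commutator a x \<in> I" "commutator a (b * x) \<in> I"
          using JT that full_normalizer_iff[OF two_sided_idealD(1)[OF I]] two_sided_idealD(6)[OF J]
          by blast+
        ultimately show ?thesis by auto
      qed
      then show ?thesis by (simp add: S_def)
    qed
  qed (use two_sided_idealD(6)[OF J] in \<open>auto simp: S_def distrib_right mult.assoc\<close>)
  then show ?thesis
    using semiprime_ideal_squareD[OF semi J] unfolding S_def by blast
qed

lemma inj_on_full_normalizer_semiprime:
  assumes "generates_ring {commutator a b | a b :: 'a::cstar_algebra. True}"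
  shows "inj_on full_normalizer {I :: 'a set. semiprime_two_sided_ideal I}"
proof -
  have "I \<subseteq> J" if "semiprime_two_sided_ideal I" "semiprime_two_sided_ideal J"
    "full_normalizer I = full_normalizer J" for I J :: "'a set"
  proof (rule ideal_in_full_normalizer[OF assms that(2)])
    show I: "two_sided_ideal I"
      using that(1) unfolding semiprime_two_sided_ideal_def by blast
    show "I \<subseteq> full_normalizer J"
      using subset_full_normalizer[OF two_sided_ideal_imp_lie_ideal[OF I]] that(3) by simp
  qed
  then show ?thesis by (simp add: inj_on_def subset_antisym)
qed

section \<open>From Lie ideals to ideals\<close>

text \<open>
  For a Lie ideal \<open>L\<close> this is the largest two-sided ideal inside \<open>L\<close>: left multiples suffice,
  because right multiples differ from them by commutators with elements of \<open>L\<close>.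
\<close>

definition ideal_core :: "'a::ring set \<Rightarrow> 'a set" where
  "ideal_core L = {x \<in> L. \<forall>a. a * x \<in> L}"

lemma ideal_core_subset: "ideal_core L \<subseteq> L"
  by (auto simp: ideal_core_def)

lemma ideal_core_greatest: "two_sided_ideal J \<Longrightarrow> J \<subseteq> L \<Longrightarrow> J \<subseteq> ideal_core L"
  unfolding ideal_core_def using two_sided_idealD(6) by blast

lemma two_sided_ideal_core:
  assumes L: "lie_ideal L"
  shows "two_sided_ideal (ideal_core L)"
  unfolding two_sided_ideal_def
proof (intro conjI allI ballI)
  have sub: "complex_vector.subspace L" using L lie_ideal_iff by blast
  show "complex_vector.subspace (ideal_core L)"
    using sub subspace_mult_left_preimage[OF sub]
    unfolding ideal_core_def complex_vector.subspace_def by simp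
  fix b x assume x: "x \<in> ideal_core L"
  then show "b * x \<in> ideal_core L"
    by (simp add: ideal_core_def mult.assoc[symmetric])
  have mult_right: "y * b \<in> L" if "y \<in> L" "b * y \<in> L" for y
  proof -
    have "y * b = commutator y b + b * y" by (simp add: commutator_def)
    then show ?thesis
      using lie_ideal_commutatorD(2)[OF L that(1)] that(2) complex_vector.subspace_add[OF sub] by metis
  qed
  then show "x * b \<in> ideal_core L"
    using x by (simp add: ideal_core_def mult.assoc[symmetric])
qed

lemma semiprime_lie_ideal_commutatorsD:
  assumes "semiprime_lie_ideal L" "lie_ideal K"
    and "\<And>u v. u \<in> K \<Longrightarrow> v \<in> K \<Longrightarrow> commutator u v \<in> L"
  shows "K \<subseteq> L"
proof -
  have "complex_vector.subspace L"
    using assms(1) unfolding semiprime_lie_ideal_def lie_ideal_def by blast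
  then have "commutator_span K K \<subseteq> L"
    by (simp add: commutator_span_subset_iff assms(3))
  then show ?thesis
    using assms(1,2) unfolding semiprime_lie_ideal_def by blast
qed

lemma semiprime_lie_ideal_full_normalizer_eq:
  assumes semi: "semiprime_lie_ideal L"
  shows "full_normalizer L = L"
proof
  have L: "lie_ideal L" using semi unfolding semiprime_lie_ideal_def by blast
  show "L \<subseteq> full_normalizer L" by (rule subset_full_normalizer[OF L])
  show "full_normalizer L \<subseteq> L"
    using semiprime_lie_ideal_commutatorsD[OF semi lie_ideal_full_normalizer[OF L]]
      full_normalizer_commutatorD(1) L lie_ideal_iff by blast
qed

lemma full_normalizer_mult_closed:
  assumes L: "complex_vector.subspace L"
    and uv: "u \<in> full_normalizer L" "v \<in> full_normalizer L"
  shows "u * v \<in> full_normalizer L"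
proof -
  have "commutator a (u * v) \<in> L" for a
  proof -
    have "commutator a (u * v) = commutator (a * u) v + commutator (v * a) u"
      by (simp add: commutator_def algebra_simps)
    then show ?thesis
      using full_normalizer_commutatorD(1)[OF L] uv complex_vector.subspace_add[OF L] by metis
  qed
  then show ?thesis using full_normalizer_iff[OF L] by blast
qed

text \<open>
  In \<open>[u, a v] = [u, a] v + a [u, v]\<close> the left-hand side lies in \<open>L\<close> because \<open>L\<close> is a Lie ideal, and
  \<open>[u, a] v\<close> because \<open>L\<close> is closed under products.
\<close>

lemma commutator_in_ideal_core:
  assumes L: "lie_ideal L" and mult: "\<And>x y. x \<in> L \<Longrightarrow> y \<in> L \<Longrightarrow> x * y \<in> L"
    and u: "u \<in> L" and v: "v \<in> L"
  shows "commutator u v \<in> ideal_core L"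
proof -
  have "a * commutator u v \<in> L" for a
  proof -
    have "a * commutator u v = commutator u (a * v) - commutator u a * v"
      by (simp add: commutator_def algebra_simps)
    then show ?thesis
      using lie_ideal_commutatorD(2)[OF L u] mult v L complex_vector.subspace_diff lie_ideal_iff
      by metis
  qed
  then show ?thesis
    using lie_ideal_commutatorD(2)[OF L u] by (simp add: ideal_core_def)
qed

lemma semiprime_ideal_core:
  assumes semi: "semiprime_lie_ideal L"
  shows "semiprime_two_sided_ideal (ideal_core L)"
proof -
  have L: "lie_ideal L" using semi unfolding semiprime_lie_ideal_def by blast
  note core = two_sided_ideal_core[OF L]
  have "J \<subseteq> ideal_core L"
    if J: "two_sided_ideal J" and JJ: "product_span J J \<subseteq> ideal_core L" for J
  proof (rule ideal_core_greatest[OF J])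
    have "u * v \<in> ideal_core L" if "u \<in> J" "v \<in> J" for u v
      using JJ that unfolding product_span_subset_iff[OF two_sided_idealD(1)[OF core]] by blast
    then have "commutator u v \<in> ideal_core L" if "u \<in> J" "v \<in> J" for u v
      using two_sided_idealD(4)[OF core] that unfolding commutator_def by simp
    then have "commutator u v \<in> L" if "u \<in> J" "v \<in> J" for u v
      using ideal_core_subset that by blast
    then show "J \<subseteq> L"
      by (rule semiprime_lie_ideal_commutatorsD[OF semi two_sided_ideal_imp_lie_ideal[OF J]])
  qed
  then show ?thesis
    using core unfolding semiprime_two_sided_ideal_def by blast
qed

lemma full_normalizer_ideal_core:
  assumes semi: "semiprime_lie_ideal L"
  shows "full_normalizer (ideal_core L) = L"
proof
  have L: "lie_ideal L" using semi unfolding semiprime_lie_ideal_def by blast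
  then have sub: "complex_vector.subspace L" using lie_ideal_iff by blast
  have T: "full_normalizer L = L" by (rule semiprime_lie_ideal_full_normalizer_eq[OF semi])
  have "full_normalizer (ideal_core L) \<subseteq> full_normalizer L"
    unfolding full_normalizer_def using ideal_core_subset by blast
  then show "full_normalizer (ideal_core L) \<subseteq> L" by (simp add: T)
  have "x * y \<in> L" if "x \<in> L" "y \<in> L" for x y
    using full_normalizer_mult_closed[OF sub] that T by simp
  then have LL: "commutator u v \<in> ideal_core L" if "u \<in> L" "v \<in> L" for u v
    by (rule commutator_in_ideal_core[OF L]) (use that in simp_all)
  show "L \<subseteq> full_normalizer (ideal_core L)"
  proof (rule semiprime_lie_ideal_commutatorsD[OF _ L])
    show "semiprime_lie_ideal (full_normalizer (ideal_core L))"
      by (rule semiprime_lie_ideal_full_normalizer[OF semiprime_ideal_core[OF semi]])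
    show "commutator u v \<in> full_normalizer (ideal_core L)" if "u \<in> L" "v \<in> L" for u v
      using LL[OF that]
        subset_full_normalizer[OF two_sided_ideal_imp_lie_ideal[OF two_sided_ideal_core[OF L]]]
      by blast
  qed
qed

text \<open>
  From \<open>J K\<close> inside the core \<open>I\<close> one obtains \<open>(K J) (K J) \<subseteq> I\<close>, hence \<open>K J \<subseteq> I\<close> by semiprimeness,
  and therefore \<open>[J, K] \<subseteq> I \<subseteq> L\<close>.
\<close>

lemma prime_ideal_core:
  assumes prime: "prime_lie_ideal L"
  shows "prime_two_sided_ideal (ideal_core L)"
proof -
  have semi: "semiprime_lie_ideal L" by (rule prime_imp_semiprime_lie_ideal[OF prime])
  have L: "lie_ideal L" and proper: "L \<noteq> UNIV"
    using prime unfolding prime_lie_ideal_def by blast+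
  then have sub: "complex_vector.subspace L" using lie_ideal_iff by blast
  note core = two_sided_ideal_core[OF L]
  have "J \<subseteq> ideal_core L \<or> K \<subseteq> ideal_core L"
    if J: "two_sided_ideal J" and K: "two_sided_ideal K"
      and sp: "product_span J K \<subseteq> ideal_core L" for J K
  proof -
    have JK: "x * y \<in> ideal_core L" if "x \<in> J" "y \<in> K" for x y
      using sp that product_span_subset_iff[OF two_sided_idealD(1)[OF core]] by blast
    have KJ: "y * x \<in> ideal_core L" if "x \<in> J" "y \<in> K" for x y
    proof (rule semiprime_elementD[OF semiprime_ideal_core[OF semi]])
      fix a
      have "x * a * y \<in> ideal_core L"
        using JK two_sided_idealD(7)[OF J] that by blast
      moreover have "y * x * a * (y * x) = y * (x * a * y) * x" by (simp add: mult.assoc)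
      ultimately show "y * x * a * (y * x) \<in> ideal_core L"
        using two_sided_idealD(6,7)[OF core] by metis
    qed
    have "commutator x y \<in> L" if "x \<in> J" "y \<in> K" for x y
      using two_sided_idealD(4)[OF core JK[OF that] KJ[OF that]] ideal_core_subset
      unfolding commutator_def by blast
    then have "commutator_span J K \<subseteq> L"
      by (simp add: commutator_span_subset_iff[OF sub])
    then have "J \<subseteq> L \<or> K \<subseteq> L"
      using prime two_sided_ideal_imp_lie_ideal[OF J] two_sided_ideal_imp_lie_ideal[OF K]
      unfolding prime_lie_ideal_def by blast
    then show ?thesis using ideal_core_greatest J K by blast
  qed
  moreover have "ideal_core L \<noteq> UNIV" using ideal_core_subset proper by blast
  ultimately show ?thesis
    using core unfolding prime_two_sided_ideal_def by blast
qed

section \<open>The correspondence\<close>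

theorem corollary2:
  assumes "generates_ring {commutator a b | a b :: 'a::cstar_algebra. True}"
  shows "bij_betw full_normalizer
           {I :: 'a set. semiprime_two_sided_ideal I} {L :: 'a set. semiprime_lie_ideal L} \<and>
         bij_betw full_normalizer
           {I :: 'a set. prime_two_sided_ideal I} {L :: 'a set. prime_lie_ideal L}"
proof (intro conjI bij_betw_imageI)
  show inj: "inj_on full_normalizer {I :: 'a set. semiprime_two_sided_ideal I}"
    by (rule inj_on_full_normalizer_semiprime[OF assms])
  show "inj_on full_normalizer {I :: 'a set. prime_two_sided_ideal I}"
    using inj by (rule inj_on_subset) (use prime_imp_semiprime_two_sided_ideal in blast)
  show "full_normalizer ` {I :: 'a set. semiprime_two_sided_ideal I} = {L. semiprime_lie_ideal L}"
    using semiprime_lie_ideal_full_normalizer semiprime_ideal_core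
      full_normalizer_ideal_core[symmetric] by blast
  show "full_normalizer ` {I :: 'a set. prime_two_sided_ideal I} = {L. prime_lie_ideal L}"
    using prime_lie_ideal_full_normalizer[OF assms] prime_ideal_core
      full_normalizer_ideal_core[OF prime_imp_semiprime_lie_ideal, symmetric] by blast
qed

end
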